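(* Let $\lambda,\varepsilon\in\mathbb{R}$ and let $r(x,t),s(x,t)$ be a solution, with $r,s\in C^\infty_\downarrow$, of the Gardner system $$r_t+r_{xxx}+rr_x+\lambda ss_x-\tfrac16\varepsilon^2\left[(r^2+\lambda s^2)r_x+2\lambda rss_x\right]=0,$$ $$s_t+s_{xxx}+rs_x+sr_x-\tfrac16\varepsilon^2\left[(r^2+\lambda s^2)s_x+2rsr_x\right]=0.$$ Then $u,v\in C^\infty_\downarrow$ defined by the Gardner transformation $$u=r+\varepsilon r_x-\tfrac16\varepsilon^2(r^2+\lambda s^2),\qquad v=s+\varepsilon s_x-\tfrac13\varepsilon^2rs$$ are solutions of $$u_t+uu_x+u_{xxx}+\lambda vv_x=0,\qquad v_t+u_xv+v_xu+v_{xxx}=0.$$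
   Context: All functions are real-valued and smooth in $(x,t)$. "$f\in C^\infty_\downarrow$" means that for each $t$ the function $x\mapsto f(x,t)$ lies in the Schwartz space $C^\infty_\downarrow(\mathbb{R})=\{f\in C^\infty(\mathbb{R}) : \lim_{x\to\pm\infty}x^p\partial_x^qf=0\text{ for all }p,q\ge0\}$. *)

theory Defs
  imports "HOL-Analysis.Analysis"
begin

definition Dx :: "(real \<Rightarrow> real \<Rightarrow> real) \<Rightarrow> real \<Rightarrow> real \<Rightarrow> real" where
  "Dx f x t = deriv (\<lambda>y. f y t) x"

definition Dt :: "(real \<Rightarrow> real \<Rightarrow> real) \<Rightarrow> real \<Rightarrow> real \<Rightarrow> real" where
  "Dt f x t = deriv (\<lambda>s. f x s) t"

(* The set T of times is meant to be open, so that the two-sided derivative in t is the right one.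
   On an open set, a function is C^k iff all its iterated partial derivatives
   of order at most k exist and are continuous. *)
fun C_k_in_xt :: "nat \<Rightarrow> real set \<Rightarrow> (real \<Rightarrow> real \<Rightarrow> real) \<Rightarrow> bool" where
  "C_k_in_xt 0 T f \<longleftrightarrow> continuous_on (UNIV \<times> T) (\<lambda>(x, t). f x t)"
| "C_k_in_xt (Suc k) T f \<longleftrightarrow>
     continuous_on (UNIV \<times> T) (\<lambda>(x, t). f x t) \<and>
     (\<forall>x. \<forall>t\<in>T. (\<lambda>y. f y t) differentiable (at x) \<and> (\<lambda>s. f x s) differentiable (at t)) \<and>
     C_k_in_xt k T (Dx f) \<and> C_k_in_xt k T (Dt f)"

definition smooth_in_xt :: "real set \<Rightarrow> (real \<Rightarrow> real \<Rightarrow> real) \<Rightarrow> bool" where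
  "smooth_in_xt T f \<longleftrightarrow> (\<forall>k. C_k_in_xt k T f)"

definition schwartz :: "(real \<Rightarrow> real) \<Rightarrow> bool" where
  "schwartz f \<longleftrightarrow>
     (\<forall>q x. (deriv ^^ q) f differentiable (at x)) \<and>
     (\<forall>p q. ((\<lambda>x. x ^ p * (deriv ^^ q) f x) \<longlongrightarrow> 0) at_top \<and>
            ((\<lambda>x. x ^ p * (deriv ^^ q) f x) \<longlongrightarrow> 0) at_bot)"

definition C_infty_down :: "real set \<Rightarrow> (real \<Rightarrow> real \<Rightarrow> real) \<Rightarrow> bool" where
  "C_infty_down T f \<longleftrightarrow> smooth_in_xt T f \<and> (\<forall>t\<in>T. schwartz (\<lambda>x. f x t))"

definition gardner_solution ::
    "real \<Rightarrow> real \<Rightarrow> real set \<Rightarrow> (real \<Rightarrow> real \<Rightarrow> real) \<Rightarrow> (real \<Rightarrow> real \<Rightarrow> real) \<Rightarrow> bool" where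
  "gardner_solution lam eps T r s \<longleftrightarrow> (\<forall>x. \<forall>t\<in>T.
     Dt r x t + Dx (Dx (Dx r)) x t + r x t * Dx r x t + lam * s x t * Dx s x t
       - 1/6 * eps\<^sup>2 * (((r x t)\<^sup>2 + lam * (s x t)\<^sup>2) * Dx r x t
                         + 2 * lam * r x t * s x t * Dx s x t) = 0 \<and>
     Dt s x t + Dx (Dx (Dx s)) x t + r x t * Dx s x t + s x t * Dx r x t
       - 1/6 * eps\<^sup>2 * (((r x t)\<^sup>2 + lam * (s x t)\<^sup>2) * Dx s x t
                         + 2 * r x t * s x t * Dx r x t) = 0)"

definition coupled_kdv_solution ::
    "real \<Rightarrow> real set \<Rightarrow> (real \<Rightarrow> real \<Rightarrow> real) \<Rightarrow> (real \<Rightarrow> real \<Rightarrow> real) \<Rightarrow> bool" where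
  "coupled_kdv_solution lam T u v \<longleftrightarrow> (\<forall>x. \<forall>t\<in>T.
     Dt u x t + u x t * Dx u x t + Dx (Dx (Dx u)) x t + lam * v x t * Dx v x t = 0 \<and>
     Dt v x t + Dx u x t * v x t + Dx v x t * u x t + Dx (Dx (Dx v)) x t = 0)"

end

theory Submission
  imports Defs
begin

text \<open>In the algebra \<open>\<real>[\<surd>lam]\<close> put \<open>R = r + s \<surd>lam\<close> and \<open>U = u + v \<surd>lam\<close>. Then the Gardner system
  is the scalar Gardner equation \<open>G(R) = 0\<close>, the transformation is
  \<open>U = R + \<epsilon> R\<^sub>x - \<epsilon>\<^sup>2 R\<^sup>2 / 6\<close>, and the classical identity
  \<open>U\<^sub>t + U U\<^sub>x + U\<^sub>x\<^sub>x\<^sub>x = (1 + \<epsilon> \<partial>\<^sub>x - \<epsilon>\<^sup>2 R / 3) G(R)\<close> gives the result, the only analytic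
  ingredient being that the partial derivatives of \<open>R\<close> commute.\<close>

section \<open>Partial derivatives\<close>

lemma Dx_cong:
  assumes "\<And>x t. t \<in> T \<Longrightarrow> f x t = g x t" "t \<in> T"
  shows "Dx f x t = Dx g x t"
  using assms by (simp add: Dx_def)

text \<open>Unlike \<open>Dx\<close>, which stays on one time slice, \<open>Dt\<close> sees
  neighbouring times. Openness of \<open>T\<close> makes the two functions agree on a whole
  neighbourhood of \<open>t\<close>.\<close>

lemma Dt_cong:
  assumes "open T" "\<And>x t. t \<in> T \<Longrightarrow> f x t = g x t" "t \<in> T"
  shows "Dt f x t = Dt g x t"
  unfolding Dt_def
proof (rule deriv_cong_ev)
  show "\<forall>\<^sub>F s in nhds t. f x s = g x s"
    using assms eventually_nhds by blast
qed simp

lemma Dx_eqI: "((\<lambda>y. f y t) has_real_derivative d) (at x) \<Longrightarrow> Dx f x t = d"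
  by (simp add: Dx_def DERIV_imp_deriv)

lemma Dt_eqI: "((\<lambda>s. f x s) has_real_derivative d) (at t) \<Longrightarrow> Dt f x t = d"
  by (simp add: Dt_def DERIV_imp_deriv)

text \<open>For iterated differentiation: the first premise takes in an explicit formula already
  known on the slice, and the second differentiates that formula instead of
  \<open>f\<close>.\<close>

lemma Dx_eqI':
  assumes "\<And>y. f y t = g y" "(g has_real_derivative d) (at x)"
  shows "Dx f x t = d"
  using assms by (intro Dx_eqI) simp

lemma Dt_eqI':
  assumes "open T" "t \<in> T" "\<And>s. s \<in> T \<Longrightarrow> f x s = g s" "(g has_real_derivative d) (at t)"
  shows "Dt f x t = d"
proof (rule Dt_eqI, rule has_field_derivative_transform_within_open)
  show "(g has_real_derivative d) (at t)" "open T" "t \<in> T" by fact+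
  show "\<And>s. s \<in> T \<Longrightarrow> g s = f x s" using assms(3) by simp
qed

lemma has_real_derivative_deriv:
  fixes f :: "real \<Rightarrow> real"
  shows "f differentiable (at x) \<Longrightarrow> (f has_real_derivative deriv f x) (at x)"
  by (simp add: DERIV_deriv_iff_real_differentiable)

lemma differentiableI_real:
  fixes f :: "real \<Rightarrow> real"
  shows "(f has_real_derivative d) (at x) \<Longrightarrow> f differentiable (at x)"
  by (auto simp: real_differentiable_def)

lemma C_Suc_has_Dx:
  assumes "C_k_in_xt (Suc k) T f" "t \<in> T"
  shows "((\<lambda>y. f y t) has_real_derivative Dx f x t) (at x)"
  using assms by (simp add: Dx_def has_real_derivative_deriv)

lemma C_Suc_has_Dt:
  assumes "C_k_in_xt (Suc k) T f" "t \<in> T"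
  shows "((\<lambda>s. f x s) has_real_derivative Dt f x t) (at t)"
  using assms by (simp add: Dt_def has_real_derivative_deriv)

lemma C_k_continuous:
  "C_k_in_xt k T f \<Longrightarrow> continuous_on (UNIV \<times> T) (\<lambda>(x, t). f x t)"
  by (cases k) auto

section \<open>Symmetry of the mixed partial derivatives\<close>

text \<open>Applying the mean value theorem twice to the second difference over a square of side \<open>h\<close>.\<close>

lemma mixed_difference:
  assumes C: "C_k_in_xt 2 T f" and "0 < h" and T: "{t..t + h} \<subseteq> T"
  obtains a b where "a \<in> {x..x + h}" "b \<in> {t..t + h}"
    "f (x + h) (t + h) - f (x + h) t - f x (t + h) + f x t = h\<^sup>2 * Dt (Dx f) a b"
proof -
  have C1: "C_k_in_xt (Suc 1) T f" and C0: "C_k_in_xt (Suc 0) T (Dx f)"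
    using C by (simp_all add: numeral_2_eq_2)
  have tT: "t \<in> T" "t + h \<in> T" using T \<open>0 < h\<close> by auto
  \<comment> \<open>The mean value theorem is applied to
    \<open>\<lambda>y. f y (t + h) - f y t\<close>; the next application is to \<open>Dx f a\<close>
    as a function of time.\<close>
  have "\<exists>z. x < z \<and> z < x + h \<and> (f (x + h) (t + h) - f (x + h) t) - (f x (t + h) - f x t)
      = (x + h - x) * (Dx f z (t + h) - Dx f z t)"
    using \<open>0 < h\<close> tT
    by (intro MVT2 DERIV_diff C_Suc_has_Dx[OF C1]) auto
  then obtain a where a: "x < a" "a < x + h"
    "(f (x + h) (t + h) - f (x + h) t) - (f x (t + h) - f x t)
      = h * (Dx f a (t + h) - Dx f a t)" by auto
  have "\<exists>z. t < z \<and> z < t + h \<and> Dx f a (t + h) - Dx f a t = (t + h - t) * Dt (Dx f) a z"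
    using \<open>0 < h\<close> T by (intro MVT2 C_Suc_has_Dt[OF C0]) auto
  then obtain b where b: "t < b" "b < t + h" "Dx f a (t + h) - Dx f a t = h * Dt (Dx f) a b"
    by auto
  show thesis
    using a b by (intro that[of a b]) (auto simp: power2_eq_square algebra_simps)
qed

text \<open>The same second difference, grouped the other way: the mean value theorem acts first in
  \<open>t\<close> and then in \<open>x\<close>, so the other mixed derivative appears, at an
  intermediate point of its own.\<close>

lemma mixed_difference':
  assumes C: "C_k_in_xt 2 T f" and "0 < h" and T: "{t..t + h} \<subseteq> T"
  obtains a b where "a \<in> {x..x + h}" "b \<in> {t..t + h}"
    "f (x + h) (t + h) - f (x + h) t - f x (t + h) + f x t = h\<^sup>2 * Dx (Dt f) a b"
proof -
  have C1: "C_k_in_xt (Suc 1) T f" and C0: "C_k_in_xt (Suc 0) T (Dt f)"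
    using C by (simp_all add: numeral_2_eq_2)
  have "\<exists>z. t < z \<and> z < t + h \<and> (f (x + h) (t + h) - f x (t + h)) - (f (x + h) t - f x t)
      = (t + h - t) * (Dt f (x + h) z - Dt f x z)"
    using \<open>0 < h\<close> T
    by (intro MVT2 DERIV_diff C_Suc_has_Dt[OF C1]) auto
  then obtain b where b: "t < b" "b < t + h"
    "(f (x + h) (t + h) - f x (t + h)) - (f (x + h) t - f x t)
      = h * (Dt f (x + h) b - Dt f x b)" by auto
  then have "b \<in> T" using T by auto
  then have "\<exists>z. x < z \<and> z < x + h \<and> Dt f (x + h) b - Dt f x b = (x + h - x) * Dx (Dt f) z b"
    using \<open>0 < h\<close> by (intro MVT2 C_Suc_has_Dx[OF C0]) auto
  then obtain a where a: "x < a" "a < x + h" "Dt f (x + h) b - Dt f x b = h * Dx (Dt f) a b"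
    by auto
  show thesis
    using a b by (intro that[of a b]) (auto simp: power2_eq_square algebra_simps)
qed

lemma close_in_square:
  fixes g :: "real \<Rightarrow> real \<Rightarrow> real"
  assumes g: "continuous_on (UNIV \<times> T) (\<lambda>(x, t). g x t)" and "open T" "t \<in> T" "0 < e"
  shows "\<forall>\<^sub>F h in at_right 0. \<forall>a\<in>{x..x + h}. \<forall>b\<in>{t..t + h}. \<bar>g a b - g x t\<bar> < e"
proof -
  have "isCont (\<lambda>(x, t). g x t) (x, t)"
    using g \<open>open T\<close> \<open>t \<in> T\<close>
    by (auto simp: continuous_on_eq_continuous_at open_Times)
  then obtain d where d: "d > 0"
    "\<And>a b. dist (a, b) (x, t) < d \<Longrightarrow> \<bar>g a b - g x t\<bar> < e"
    using \<open>0 < e\<close> by (fastforce simp: continuous_at_eps_delta dist_real_def)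
  show ?thesis
    unfolding eventually_at_right_field
  \<comment> \<open>The distance is at most the sum of the two coordinate differences, each at most
    \<open>h\<close>, so \<open>h < d / 2\<close> keeps the square inside the ball of radius
    \<open>d\<close>.\<close>
  proof (intro exI[of _ "d / 2"] conjI allI impI ballI)
    fix h a b assume h: "0 < h" "h < d / 2" and a: "a \<in> {x..x + h}" and b: "b \<in> {t..t + h}"
    have "dist (a, b) (x, t) \<le> \<bar>a - x\<bar> + \<bar>b - t\<bar>"
      by (simp add: dist_prod_def dist_real_def sqrt_sum_squares_le_sum_abs)
    then show "\<bar>g a b - g x t\<bar> < e" using a b h by (intro d(2)) auto
  qed (use d in auto)
qed

text \<open>Divided by \<open>h\<^sup>2\<close>, the second difference is a value of either mixed
  derivative somewhere in the square of side \<open>h\<close>. Both derivatives are continuous, so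
  for small \<open>h\<close> these equal values would lie close to two different limits.\<close>

lemma mixed_partials_commute:
  assumes C: "C_k_in_xt 2 T f" and T: "open T" "t \<in> T"
  shows "Dt (Dx f) x t = Dx (Dt f) x t"
proof (rule ccontr)
  assume neq: "Dt (Dx f) x t \<noteq> Dx (Dt f) x t"
  \<comment> \<open>Half the supposed gap: no number is within \<open>e\<close> of both mixed
    derivatives at \<open>(x, t)\<close>.\<close>
  define e where "e = \<bar>Dt (Dx f) x t - Dx (Dt f) x t\<bar> / 2"
  have "e > 0" using neq by (simp add: e_def)
  have cont: "continuous_on (UNIV \<times> T) (\<lambda>(x, t). Dt (Dx f) x t)"
    "continuous_on (UNIV \<times> T) (\<lambda>(x, t). Dx (Dt f) x t)"
    using C by (simp_all add: numeral_2_eq_2)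
  obtain d where d: "d > 0" "\<And>s. dist s t < d \<Longrightarrow> s \<in> T"
    using T open_dist by metis
  have "\<forall>\<^sub>F h in at_right 0. {t..t + h} \<subseteq> T"
    unfolding eventually_at_right_field
    using d by (intro exI[of _ d]) (auto simp: dist_real_def)
  then have ev: "\<forall>\<^sub>F h in at_right 0. 0 < h \<and> {t..t + h} \<subseteq> T \<and>
      (\<forall>a\<in>{x..x + h}. \<forall>b\<in>{t..t + h}. \<bar>Dt (Dx f) a b - Dt (Dx f) x t\<bar> < e) \<and>
      (\<forall>a\<in>{x..x + h}. \<forall>b\<in>{t..t + h}. \<bar>Dx (Dt f) a b - Dx (Dt f) x t\<bar> < e)"
    using close_in_square[OF cont(1) T \<open>e > 0\<close>] close_in_square[OF cont(2) T \<open>e > 0\<close>]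
    by (intro eventually_conj eventually_at_right_less)
  then obtain h where h: "0 < h" "{t..t + h} \<subseteq> T"
    "\<And>a b. a \<in> {x..x + h} \<Longrightarrow> b \<in> {t..t + h} \<Longrightarrow> \<bar>Dt (Dx f) a b - Dt (Dx f) x t\<bar> < e"
    "\<And>a b. a \<in> {x..x + h} \<Longrightarrow> b \<in> {t..t + h} \<Longrightarrow> \<bar>Dx (Dt f) a b - Dx (Dt f) x t\<bar> < e"
    using eventually_happens'[OF trivial_limit_at_right_real ev] by blast
  obtain a b where ab: "a \<in> {x..x + h}" "b \<in> {t..t + h}"
    "f (x + h) (t + h) - f (x + h) t - f x (t + h) + f x t = h\<^sup>2 * Dt (Dx f) a b"
    using mixed_difference[OF C h(1,2)] .
  obtain a' b' where ab': "a' \<in> {x..x + h}" "b' \<in> {t..t + h}"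
    "f (x + h) (t + h) - f (x + h) t - f x (t + h) + f x t = h\<^sup>2 * Dx (Dt f) a' b'"
    using mixed_difference'[OF C h(1,2)] .
  have "Dt (Dx f) a b = Dx (Dt f) a' b'" using ab(3) ab'(3) h(1) by simp
  then show False
    using h(3)[OF ab(1,2)] h(4)[OF ab'(1,2)] e_def
      abs_triangle_ineq4[of "Dt (Dx f) a b - Dx (Dt f) x t" "Dt (Dx f) a b - Dt (Dx f) x t"]
    by simp
qed

section \<open>Smooth functions\<close>

text \<open>Differentiation rules give formulas for \<open>Dx\<close> and \<open>Dt\<close> only at
  times in \<open>T\<close>, while \<open>C_k_in_xt\<close> takes total functions. This lemma allows
  such a formula to replace the derivative.\<close>

lemma C_k_cong:
  assumes "open T"
  shows "(\<And>x t. t \<in> T \<Longrightarrow> f x t = g x t) \<Longrightarrow> C_k_in_xt k T f \<Longrightarrow> C_k_in_xt k T g"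
proof (induction k arbitrary: f g)
  case 0
  then show ?case by (auto elim!: continuous_on_eq)
next
  case (Suc k)
  have cont: "continuous_on (UNIV \<times> T) (\<lambda>(x, t). g x t)"
    using Suc.prems by (auto elim!: continuous_on_eq)
  have "(\<lambda>y. g y t) differentiable (at x) \<and> (\<lambda>s. g x s) differentiable (at t)" if "t \<in> T" for x t
  proof
    show "(\<lambda>y. g y t) differentiable (at x)"
      using Suc.prems that by simp
    have "((\<lambda>s. g x s) has_real_derivative Dt f x t) (at t)"
    proof (rule has_field_derivative_transform_within_open)
      show "((\<lambda>s. f x s) has_real_derivative Dt f x t) (at t)"
        by (rule C_Suc_has_Dt[OF Suc.prems(2) that])
    qed (use Suc.prems(1) that \<open>open T\<close> in simp_all)
    then show "(\<lambda>s. g x s) differentiable (at t)" by (rule differentiableI_real)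
  qed
  moreover have "C_k_in_xt k T (Dx g)" "C_k_in_xt k T (Dt g)"
    using Suc.IH[of "Dx f" "Dx g"] Suc.IH[of "Dt f" "Dt g"] Suc.prems
      Dx_cong[OF Suc.prems(1)] Dt_cong[OF \<open>open T\<close> Suc.prems(1)] by simp_all
  ultimately show ?case using cont by simp
qed

lemma C_k_Suc_imp: "C_k_in_xt (Suc k) T f \<Longrightarrow> C_k_in_xt k T f"
proof (induction k arbitrary: f)
  case (Suc k)
  then have "C_k_in_xt k T (Dx f)" "C_k_in_xt k T (Dt f)"
    using C_k_in_xt.simps(2)[of "Suc k" T f] by blast+
  with Suc.prems show ?case by simp
qed simp

section \<open>Constants, sums and products of functions of class C^k\<close>

lemma C_k_const: "C_k_in_xt k T (\<lambda>x t. c)"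
proof (induction k arbitrary: c)
  case (Suc k)
  have "Dx (\<lambda>x t. c) = (\<lambda>x t. 0)" "Dt (\<lambda>x t. c) = (\<lambda>x t. 0)"
    by (auto simp: Dx_def Dt_def fun_eq_iff)
  with Suc show ?case by (simp add: case_prod_unfold)
qed (simp add: case_prod_unfold)

lemma C_k_add:
  assumes "open T"
  shows "C_k_in_xt k T f \<Longrightarrow> C_k_in_xt k T g \<Longrightarrow> C_k_in_xt k T (\<lambda>x t. f x t + g x t)"
proof (induction k arbitrary: f g)
  case 0
  then show ?case by (auto simp: case_prod_unfold intro: continuous_on_add)
next
  case (Suc k)
  note f = Suc.prems(1) and g = Suc.prems(2)
  have cont: "continuous_on (UNIV \<times> T) (\<lambda>(x, t). f x t + g x t)"
    using C_k_continuous[OF f] C_k_continuous[OF g]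
    by (auto simp: case_prod_unfold intro: continuous_on_add)
  have dx: "((\<lambda>y. f y t + g y t) has_real_derivative Dx f x t + Dx g x t) (at x)"
    and dt: "((\<lambda>s. f x s + g x s) has_real_derivative Dt f x t + Dt g x t) (at t)"
    if "t \<in> T" for x t
    by (intro DERIV_add C_Suc_has_Dx[OF f that] C_Suc_has_Dx[OF g that]
        C_Suc_has_Dt[OF f that] C_Suc_has_Dt[OF g that])+
  have "C_k_in_xt k T (\<lambda>x t. Dx f x t + Dx g x t)" "C_k_in_xt k T (\<lambda>x t. Dt f x t + Dt g x t)"
    using f g by (auto intro: Suc.IH)
  note D = this
  have "C_k_in_xt k T (Dx (\<lambda>x t. f x t + g x t))"
    by (rule C_k_cong[OF assms _ D(1)]) (rule Dx_eqI[symmetric], rule dx)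
  moreover have "C_k_in_xt k T (Dt (\<lambda>x t. f x t + g x t))"
    by (rule C_k_cong[OF assms _ D(2)]) (rule Dt_eqI[symmetric], rule dt)
  ultimately show ?case
    using cont by (simp add: differentiableI_real[OF dx] differentiableI_real[OF dt])
qed

lemma C_k_mult:
  assumes "open T"
  shows "C_k_in_xt k T f \<Longrightarrow> C_k_in_xt k T g \<Longrightarrow> C_k_in_xt k T (\<lambda>x t. f x t * g x t)"
proof (induction k arbitrary: f g)
  case 0
  then show ?case by (auto simp: case_prod_unfold intro: continuous_on_mult)
next
  case (Suc k)
  note f = Suc.prems(1) and g = Suc.prems(2)
  have cont: "continuous_on (UNIV \<times> T) (\<lambda>(x, t). f x t * g x t)"
    using C_k_continuous[OF f] C_k_continuous[OF g]
    by (auto simp: case_prod_unfold intro: continuous_on_mult)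
  have dx: "((\<lambda>y. f y t * g y t) has_real_derivative Dx f x t * g x t + Dx g x t * f x t) (at x)"
    and dt: "((\<lambda>s. f x s * g x s) has_real_derivative Dt f x t * g x t + Dt g x t * f x t) (at t)"
    if "t \<in> T" for x t
    by (intro DERIV_mult C_Suc_has_Dx[OF f that] C_Suc_has_Dx[OF g that]
        C_Suc_has_Dt[OF f that] C_Suc_has_Dt[OF g that])+
  \<comment> \<open>The product rule keeps one factor undifferentiated, so
    \<open>C_k_Suc_imp\<close> lowers its order by one before the induction hypothesis
    applies.\<close>
  have "C_k_in_xt k T (\<lambda>x t. Dx f x t * g x t + Dx g x t * f x t)"
    "C_k_in_xt k T (\<lambda>x t. Dt f x t * g x t + Dt g x t * f x t)"
    using f g C_k_Suc_imp[OF f] C_k_Suc_imp[OF g]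
    by (auto intro!: C_k_add[OF assms] Suc.IH)
  note D = this
  have "C_k_in_xt k T (Dx (\<lambda>x t. f x t * g x t))"
    by (rule C_k_cong[OF assms _ D(1)]) (rule Dx_eqI[symmetric], rule dx)
  moreover have "C_k_in_xt k T (Dt (\<lambda>x t. f x t * g x t))"
    by (rule C_k_cong[OF assms _ D(2)]) (rule Dt_eqI[symmetric], rule dt)
  ultimately show ?case
    using cont by (simp add: differentiableI_real[OF dx] differentiableI_real[OF dt])
qed

lemma smooth_Dx: "smooth_in_xt T f \<Longrightarrow> smooth_in_xt T (Dx f)"
  unfolding smooth_in_xt_def by (metis C_k_in_xt.simps(2))

lemma smooth_has_Dx:
  "smooth_in_xt T f \<Longrightarrow> t \<in> T \<Longrightarrow> ((\<lambda>y. f y t) has_real_derivative Dx f x t) (at x)"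
  unfolding smooth_in_xt_def using C_Suc_has_Dx by blast

lemma smooth_has_Dt:
  "smooth_in_xt T f \<Longrightarrow> t \<in> T \<Longrightarrow> ((\<lambda>s. f x s) has_real_derivative Dt f x t) (at t)"
  unfolding smooth_in_xt_def using C_Suc_has_Dt by blast

section \<open>Schwartz functions\<close>

text \<open>A finite-order version of \<open>schwartz\<close> that recurses through
  \<open>deriv f\<close>. Closure under products then follows by induction from the one-step product
  rule, without the Leibniz formula for higher derivatives.\<close>

fun schwartz_upto :: "nat \<Rightarrow> (real \<Rightarrow> real) \<Rightarrow> bool" where
  "schwartz_upto 0 f \<longleftrightarrow>
     (\<forall>p. ((\<lambda>x. x ^ p * f x) \<longlongrightarrow> 0) at_top \<and> ((\<lambda>x. x ^ p * f x) \<longlongrightarrow> 0) at_bot)"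
| "schwartz_upto (Suc k) f \<longleftrightarrow>
     schwartz_upto 0 f \<and> (\<forall>x. f differentiable (at x)) \<and> schwartz_upto k (deriv f)"

lemma schwartz_upto_Suc_imp: "schwartz_upto (Suc k) f \<Longrightarrow> schwartz_upto k f"
proof (induction k arbitrary: f)
  case (Suc k)
  then have "schwartz_upto k (deriv f)" using schwartz_upto.simps(2) by blast
  with Suc.prems show ?case by simp
qed simp

lemma schwartz_upto_higher_deriv:
  "schwartz_upto k f \<Longrightarrow> q \<le> k \<Longrightarrow> schwartz_upto (k - q) ((deriv ^^ q) f)"
proof (induction q)
  case (Suc q)
  then have "schwartz_upto (Suc (k - Suc q)) ((deriv ^^ q) f)" by (simp add: Suc_diff_Suc)
  then show ?case by simp
qed simp

lemma schwartz_iff_upto: "schwartz f \<longleftrightarrow> (\<forall>k. schwartz_upto k f)"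
proof
  \<comment> \<open>Stated for every \<open>q\<close> so that the induction on \<open>k\<close> can
    pass from the \<open>q\<close>-th derivative to the next; only \<open>q = 0\<close> is
    wanted.\<close>
  have "schwartz_upto k ((deriv ^^ q) f)" if "schwartz f" for k q
  proof (induction k arbitrary: q)
    case 0
    then show ?case using that by (simp add: schwartz_def)
  next
    case (Suc k)
    have "schwartz_upto k (deriv ((deriv ^^ q) f))" using Suc[of "Suc q"] by simp
    then show ?case using that by (simp add: schwartz_def)
  qed
  from this[of _ 0] show "\<forall>k. schwartz_upto k f" if "schwartz f" using that by simp
next
  assume k: "\<forall>k. schwartz_upto k f"
  \<comment> \<open>Order 1 supplies exactly what \<open>schwartz\<close> asks of the
    \<open>q\<close>-th derivative: decay and differentiability. Hence order \<open>Suc q\<close> is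
    taken for \<open>f\<close>.\<close>
  have "schwartz_upto 1 ((deriv ^^ q) f)" for q
    using schwartz_upto_higher_deriv[of "Suc q" f q] k by simp
  then show "schwartz f" by (simp add: schwartz_def)
qed

lemma schwartz_upto_0_add:
  "schwartz_upto 0 f \<Longrightarrow> schwartz_upto 0 g \<Longrightarrow> schwartz_upto 0 (\<lambda>x. f x + g x)"
  by (auto simp: distrib_left intro!: tendsto_add_zero)

lemma schwartz_upto_0_mult:
  assumes "schwartz_upto 0 f" "schwartz_upto 0 g"
  shows "schwartz_upto 0 (\<lambda>x. f x * g x)"
proof -
  \<comment> \<open>The whole weight goes to \<open>f\<close>; the factor \<open>g\<close> still
    tends to zero, by its decay with exponent 0.\<close>
  have "((\<lambda>x. (x ^ p * f x) * (x ^ 0 * g x)) \<longlongrightarrow> 0) F" if "F = at_top \<or> F = at_bot" for p F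
    using assms that unfolding schwartz_upto.simps by (intro tendsto_mult_zero[of "\<lambda>x. x ^ p * f x"]) blast+
  then show ?thesis by (simp add: mult.assoc)
qed

lemma schwartz_upto_add:
  "schwartz_upto k f \<Longrightarrow> schwartz_upto k g \<Longrightarrow> schwartz_upto k (\<lambda>x. f x + g x)"
proof (induction k arbitrary: f g)
  case 0
  then show ?case by (rule schwartz_upto_0_add)
next
  case (Suc k)
  have d: "((\<lambda>x. f x + g x) has_real_derivative deriv f x + deriv g x) (at x)" for x
    using Suc.prems by (intro DERIV_add has_real_derivative_deriv) simp_all
  then have "deriv (\<lambda>x. f x + g x) = (\<lambda>x. deriv f x + deriv g x)"
    by (auto intro: DERIV_imp_deriv)
  moreover have "schwartz_upto k (\<lambda>x. deriv f x + deriv g x)"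
    using Suc by simp
  moreover have "schwartz_upto 0 (\<lambda>x. f x + g x)"
    using Suc.prems by (intro schwartz_upto_0_add) simp_all
  ultimately show ?case using d differentiableI_real by (metis schwartz_upto.simps(2))
qed

lemma schwartz_upto_mult:
  "schwartz_upto k f \<Longrightarrow> schwartz_upto k g \<Longrightarrow> schwartz_upto k (\<lambda>x. f x * g x)"
proof (induction k arbitrary: f g)
  case 0
  then show ?case by (rule schwartz_upto_0_mult)
next
  case (Suc k)
  have d: "((\<lambda>x. f x * g x) has_real_derivative deriv f x * g x + deriv g x * f x) (at x)" for x
    using Suc.prems by (intro DERIV_mult has_real_derivative_deriv) simp_all
  then have "deriv (\<lambda>x. f x * g x) = (\<lambda>x. deriv f x * g x + deriv g x * f x)"
    by (auto intro: DERIV_imp_deriv)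
  moreover have "schwartz_upto k (\<lambda>x. deriv f x * g x + deriv g x * f x)"
    using Suc.prems schwartz_upto_Suc_imp[OF Suc.prems(1)] schwartz_upto_Suc_imp[OF Suc.prems(2)]
    by (intro schwartz_upto_add Suc.IH) simp_all
  moreover have "schwartz_upto 0 (\<lambda>x. f x * g x)"
    using Suc.prems by (intro schwartz_upto_0_mult) simp_all
  ultimately show ?case using d differentiableI_real by (metis schwartz_upto.simps(2))
qed

text \<open>A nonzero constant does not decay, so scalar multiples are not instances of the product
  lemma.\<close>

lemma schwartz_upto_cmult: "schwartz_upto k f \<Longrightarrow> schwartz_upto k (\<lambda>x. c * f x)"
proof (induction k arbitrary: f)
  case 0
  then show ?case by (auto simp: mult.left_commute[of _ c] intro!: tendsto_mult_right_zero)
next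
  case (Suc k)
  have d: "((\<lambda>x. c * f x) has_real_derivative c * deriv f x) (at x)" for x
    using Suc.prems by (intro DERIV_cmult has_real_derivative_deriv) simp_all
  then have "deriv (\<lambda>x. c * f x) = (\<lambda>x. c * deriv f x)"
    by (auto intro: DERIV_imp_deriv)
  moreover have "schwartz_upto k (\<lambda>x. c * deriv f x)"
    using Suc by simp
  moreover have "schwartz_upto 0 (\<lambda>x. c * f x)"
    using Suc.prems by (auto simp: mult.left_commute[of _ c] intro!: tendsto_mult_right_zero)
  ultimately show ?case using d differentiableI_real by (metis schwartz_upto.simps(2))
qed

section \<open>Closure properties of \<open>C_infty_down\<close>\<close>

lemma C_infty_down_cong:
  assumes "open T" "C_infty_down T f" "\<And>x t. t \<in> T \<Longrightarrow> g x t = f x t"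
  shows "C_infty_down T g"
  using assms C_k_cong[OF \<open>open T\<close>, of f g] by (simp add: C_infty_down_def smooth_in_xt_def)

lemma C_infty_down_add:
  assumes "open T" "C_infty_down T f" "C_infty_down T g"
  shows "C_infty_down T (\<lambda>x t. f x t + g x t)"
  using assms
  by (simp add: C_infty_down_def smooth_in_xt_def C_k_add schwartz_iff_upto schwartz_upto_add)

lemma C_infty_down_mult:
  assumes "open T" "C_infty_down T f" "C_infty_down T g"
  shows "C_infty_down T (\<lambda>x t. f x t * g x t)"
  using assms
  by (simp add: C_infty_down_def smooth_in_xt_def C_k_mult schwartz_iff_upto schwartz_upto_mult)

lemma C_infty_down_cmult:
  assumes "open T" "C_infty_down T f"
  shows "C_infty_down T (\<lambda>x t. c * f x t)"
  using assms
  by (simp add: C_infty_down_def smooth_in_xt_def C_k_mult C_k_const schwartz_iff_upto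
      schwartz_upto_cmult)

lemma C_infty_down_Dx:
  assumes "C_infty_down T f"
  shows "C_infty_down T (Dx f)"
proof -
  have "schwartz (deriv (\<lambda>x. f x t))" if "t \<in> T" for t
    using assms that schwartz_upto.simps(2)
    unfolding C_infty_down_def schwartz_iff_upto by blast
  then show ?thesis
    using assms smooth_Dx by (auto simp: C_infty_down_def Dx_def[abs_def])
qed

section \<open>The Gardner transformation\<close>

text \<open>The scalar identity is checked in components. Once the Gardner system has eliminated all
  \<open>t\<close>-derivatives, both claims are polynomial identities in \<open>lam\<close>,
  \<open>a\<close> and the \<open>x\<close>-derivatives of \<open>r\<close> and
  \<open>s\<close>.\<close>

lemma gardner_transformation_coupled_kdv:
  fixes lam eps :: real
  assumes T: "open T"
    and r: "smooth_in_xt T r" and s: "smooth_in_xt T s"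
    and G: "gardner_solution lam eps T r s"
    and u: "\<And>x t. t \<in> T \<Longrightarrow>
           u x t = r x t + eps * Dx r x t - 1/6 * eps\<^sup>2 * ((r x t)\<^sup>2 + lam * (s x t)\<^sup>2)"
    and v: "\<And>x t. t \<in> T \<Longrightarrow>
           v x t = s x t + eps * Dx s x t - 1/3 * eps\<^sup>2 * r x t * s x t"
  shows "coupled_kdv_solution lam T u v"
  unfolding coupled_kdv_solution_def
proof (intro allI ballI)
  fix x t assume t: "t \<in> T"
  \<comment> \<open>Order four is reached because \<open>u\<close> contains \<open>r1\<close> and
    three further \<open>x\<close>-derivatives are taken.\<close>
  define r1 r2 r3 r4 where "r1 = Dx r" and "r2 = Dx r1" and "r3 = Dx r2" and "r4 = Dx r3"
  define s1 s2 s3 s4 where "s1 = Dx s" and "s2 = Dx s1" and "s3 = Dx s2" and "s4 = Dx s3"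
  note defs = r1_def r2_def r3_def r4_def s1_def s2_def s3_def s4_def
  have sm: "smooth_in_xt T r1" "smooth_in_xt T r2" "smooth_in_xt T r3"
    "smooth_in_xt T s1" "smooth_in_xt T s2" "smooth_in_xt T s3"
    unfolding defs by (intro smooth_Dx r s)+
  \<comment> \<open>\<open>DERIV_cong\<close> leaves the value of each derivative as an equation, to
    be settled by simplification.\<close>
  note dx [derivative_intros] =
    smooth_has_Dx[OF r t, folded r1_def, THEN DERIV_cong]
    smooth_has_Dx[OF sm(1) t, folded r2_def, THEN DERIV_cong]
    smooth_has_Dx[OF sm(2) t, folded r3_def, THEN DERIV_cong]
    smooth_has_Dx[OF sm(3) t, folded r4_def, THEN DERIV_cong]
    smooth_has_Dx[OF s t, folded s1_def, THEN DERIV_cong]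
    smooth_has_Dx[OF sm(4) t, folded s2_def, THEN DERIV_cong]
    smooth_has_Dx[OF sm(5) t, folded s3_def, THEN DERIV_cong]
    smooth_has_Dx[OF sm(6) t, folded s4_def, THEN DERIV_cong]
  note dt [derivative_intros] =
    smooth_has_Dt[OF r t, THEN DERIV_cong] smooth_has_Dt[OF s t, THEN DERIV_cong]
    smooth_has_Dt[OF sm(1) t, THEN DERIV_cong] smooth_has_Dt[OF sm(4) t, THEN DERIV_cong]
  \<comment> \<open>clears all denominators, so that \<open>algebra\<close> can finish\<close>
  define a where "a = eps / 6"
  have eps: "eps = 6 * a" by (simp add: a_def)

  \<comment> \<open>Here \<open>eps\<^sup>2 / 6\<close> has become \<open>6 * a\<^sup>2\<close> and
    \<open>eps\<^sup>2 / 3\<close> has become \<open>12 * a\<^sup>2\<close>. The time is left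
    variable because these formulas are also differentiated in \<open>t\<close>.\<close>
  have u0: "u y \<tau> = r y \<tau> + 6 * a * r1 y \<tau> - 6 * a\<^sup>2 * ((r y \<tau>)\<^sup>2 + lam * (s y \<tau>)\<^sup>2)"
    and v0: "v y \<tau> = s y \<tau> + 6 * a * s1 y \<tau> - 12 * a\<^sup>2 * r y \<tau> * s y \<tau>"
    if "\<tau> \<in> T" for y \<tau>
    using u v that by (simp_all add: r1_def s1_def eps power2_eq_square)
  have u1: "Dx u y t = r1 y t + 6 * a * r2 y t
      - 12 * a\<^sup>2 * (r y t * r1 y t + lam * s y t * s1 y t)" for y
    by (rule Dx_eqI') (rule u0[OF t], auto intro!: derivative_eq_intros simp: algebra_simps)
  have u2: "Dx (Dx u) y t = r2 y t + 6 * a * r3 y t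
      - 12 * a\<^sup>2 * ((r1 y t)\<^sup>2 + r y t * r2 y t + lam * ((s1 y t)\<^sup>2 + s y t * s2 y t))" for y
    by (rule Dx_eqI') (rule u1, auto intro!: derivative_eq_intros simp: algebra_simps power2_eq_square)
  have u3: "Dx (Dx (Dx u)) y t = r3 y t + 6 * a * r4 y t
      - 12 * a\<^sup>2 * (3 * r1 y t * r2 y t + r y t * r3 y t
          + lam * (3 * s1 y t * s2 y t + s y t * s3 y t))" for y
    by (rule Dx_eqI') (rule u2, auto intro!: derivative_eq_intros simp: algebra_simps power2_eq_square)
  have v1: "Dx v y t = s1 y t + 6 * a * s2 y t
      - 12 * a\<^sup>2 * (r1 y t * s y t + r y t * s1 y t)" for y
    by (rule Dx_eqI') (rule v0[OF t], auto intro!: derivative_eq_intros simp: algebra_simps)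
  have v2: "Dx (Dx v) y t = s2 y t + 6 * a * s3 y t
      - 12 * a\<^sup>2 * (r2 y t * s y t + 2 * r1 y t * s1 y t + r y t * s2 y t)" for y
    by (rule Dx_eqI') (rule v1, auto intro!: derivative_eq_intros simp: algebra_simps)
  have v3: "Dx (Dx (Dx v)) y t = s3 y t + 6 * a * s4 y t
      - 12 * a\<^sup>2 * (r3 y t * s y t + 3 * r2 y t * s1 y t + 3 * r1 y t * s2 y t + r y t * s3 y t)"
    for y
    by (rule Dx_eqI') (rule v2, auto intro!: derivative_eq_intros simp: algebra_simps)

  \<comment> \<open>The Gardner system solved for the time derivatives, at every \<open>y\<close>,
    so that it can itself be differentiated in \<open>x\<close>.\<close>
  have rt: "Dt r y t = - r3 y t - r y t * r1 y t - lam * s y t * s1 y t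
      + 6 * a\<^sup>2 * (((r y t)\<^sup>2 + lam * (s y t)\<^sup>2) * r1 y t + 2 * lam * r y t * s y t * s1 y t)"
    and st: "Dt s y t = - s3 y t - r y t * s1 y t - s y t * r1 y t
      + 6 * a\<^sup>2 * (((r y t)\<^sup>2 + lam * (s y t)\<^sup>2) * s1 y t + 2 * r y t * s y t * r1 y t)" for y
    using G[unfolded gardner_solution_def, rule_format, OF t, of y]
    unfolding defs by (simp_all add: eps power2_eq_square algebra_simps)
  \<comment> \<open>The terms \<open>eps * Dx r\<close> and \<open>eps * Dx s\<close> of the
    transformation bring in \<open>Dt r1\<close> and \<open>Dt s1\<close>; commuting the derivatives
    reduces these to \<open>x\<close>-derivatives of \<open>rt\<close> and
    \<open>st\<close>.\<close>
  have comm: "Dt r1 x t = Dx (Dt r) x t" "Dt s1 x t = Dx (Dt s) x t"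
    unfolding r1_def s1_def
    using r s T t by (auto simp: smooth_in_xt_def intro: mixed_partials_commute)
  have r1t: "Dt r1 x t = - r4 x t - (r1 x t)\<^sup>2 - r x t * r2 x t
      - lam * ((s1 x t)\<^sup>2 + s x t * s2 x t)
      + 6 * a\<^sup>2 * ((2 * r x t * r1 x t + 2 * lam * s x t * s1 x t) * r1 x t
          + ((r x t)\<^sup>2 + lam * (s x t)\<^sup>2) * r2 x t
          + 2 * lam * (r1 x t * s x t * s1 x t + r x t * (s1 x t)\<^sup>2 + r x t * s x t * s2 x t))"
    unfolding comm(1)
    by (rule Dx_eqI') (rule rt, auto intro!: derivative_eq_intros simp: algebra_simps power2_eq_square)
  have s1t: "Dt s1 x t = - s4 x t - 2 * r1 x t * s1 x t - r x t * s2 x t - s x t * r2 x t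
      + 6 * a\<^sup>2 * ((2 * r x t * r1 x t + 2 * lam * s x t * s1 x t) * s1 x t
          + ((r x t)\<^sup>2 + lam * (s x t)\<^sup>2) * s2 x t
          + 2 * ((r1 x t)\<^sup>2 * s x t + r x t * s1 x t * r1 x t + r x t * s x t * r2 x t))"
    unfolding comm(2)
    by (rule Dx_eqI') (rule st, auto intro!: derivative_eq_intros simp: algebra_simps power2_eq_square)
  have ut: "Dt u x t = Dt r x t + 6 * a * Dt r1 x t
      - 12 * a\<^sup>2 * (r x t * Dt r x t + lam * s x t * Dt s x t)"
    by (rule Dt_eqI'[OF T t], erule u0) (auto intro!: derivative_eq_intros simp: algebra_simps)
  have vt: "Dt v x t = Dt s x t + 6 * a * Dt s1 x t
      - 12 * a\<^sup>2 * (Dt r x t * s x t + r x t * Dt s x t)"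
    by (rule Dt_eqI'[OF T t], erule v0) (auto intro!: derivative_eq_intros simp: algebra_simps)

  show "Dt u x t + u x t * Dx u x t + Dx (Dx (Dx u)) x t + lam * v x t * Dx v x t = 0 \<and>
        Dt v x t + Dx u x t * v x t + Dx v x t * u x t + Dx (Dx (Dx v)) x t = 0"
    unfolding ut vt r1t s1t rt st u3 v3 u1 v1 u0[OF t] v0[OF t]
    by (rule conjI; algebra)
qed

theorem lemma1:
  fixes lam eps :: real and T :: "real set"
    and r s u v :: "real \<Rightarrow> real \<Rightarrow> real"
  assumes "open T"
    and "C_infty_down T r" and "C_infty_down T s"
    and "gardner_solution lam eps T r s"
    and "\<And>x t. t \<in> T \<Longrightarrow>
           u x t = r x t + eps * Dx r x t - 1/6 * eps\<^sup>2 * ((r x t)\<^sup>2 + lam * (s x t)\<^sup>2)"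
    and "\<And>x t. t \<in> T \<Longrightarrow>
           v x t = s x t + eps * Dx s x t - 1/3 * eps\<^sup>2 * r x t * s x t"
  shows "C_infty_down T u \<and> C_infty_down T v \<and> coupled_kdv_solution lam T u v"
proof (intro conjI)
  note r = assms(2) and s = assms(3)
  note closed = C_infty_down_add[OF \<open>open T\<close>] C_infty_down_mult[OF \<open>open T\<close>]
    C_infty_down_cmult[OF \<open>open T\<close>] C_infty_down_Dx
  \<comment> \<open>Differences and squares are rewritten as sums, products and scalar multiples, to
    which the rules in \<open>closed\<close> apply; the same is done for \<open>v\<close>.\<close>
  have "C_infty_down T (\<lambda>x t. r x t + (eps * Dx r x t
      + (- 1/6 * eps\<^sup>2) * (r x t * r x t + lam * (s x t * s x t))))"
    by (intro closed r s)
  then show "C_infty_down T u"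
    by (rule C_infty_down_cong[OF \<open>open T\<close>]) (simp add: assms(5) power2_eq_square)
  have "C_infty_down T (\<lambda>x t. s x t + (eps * Dx s x t + (- 1/3 * eps\<^sup>2) * (r x t * s x t)))"
    by (intro closed r s)
  then show "C_infty_down T v"
    by (rule C_infty_down_cong[OF \<open>open T\<close>]) (simp add: assms(6) mult.assoc)
  show "coupled_kdv_solution lam T u v"
    using assms r s by (intro gardner_transformation_coupled_kdv[OF \<open>open T\<close>, of r s]) (auto simp: C_infty_down_def)
qed

end
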